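(* Let $L$ be an environment, $T_1$ a term and $A$ an arity with $L\vdash T_1::A$. Then for every $n\in\mathbb N$ there exists a term $T_2$ such that $L\vdash T_1\to^{*n}T_2$ and $T_2$ is r-normal in $L$.
   Context: Fix a nonempty set $\Sigma$ of sorts with decidable equality, an arbitrary function $\mathrm{next}:\Sigma\to\Sigma$, and a countably infinite set of variables. Terms and environments: $T,U,V,W ::= \star s \mid x \mid \mathrm{app}(V,T) \mid \lambda x{:}W.\,T \mid \mathrm{def}(x{=}V).\,T \mid \mathrm{cast}(U,T)$ ($s\in\Sigma$) and $L,K ::= \emptyset \mid K,x{:}W \mid K,x{=}V$. $\mathrm{app}(V,T)$ applies $T$ to $V$; $\lambda x{:}W.\,T$ (de Bruijn's abstraction) and $\mathrm{def}(x{=}V).\,T$ (local definition) bind $x$ in $T$; $\mathrm{cast}(U,T)$ annotates $T$ with expected type $U$; entries $x{:}W$ and $x{=}V$ bind $x$. Terms are modulo renaming of bound variables. Write $\mathsf{B}x[V]$ for either $\lambda x{:}V$ or $\mathrm{def}(x{=}V)$ and correspondingly $L,x[V]$ for $L,x{:}V$ resp. $L,x{=}V$. One step of bound rt-reduction $L\vdash T_1\to^nT_2$ is the smallest relation closed under: $L\vdash\mathrm{app}(V,\lambda x{:}W.\,T)\to^0\mathrm{def}(x{=}\mathrm{cast}(W,V)).\,T$; $K,x{=}V\vdash x\to^0V$; $L\vdash\mathrm{def}(x{=}V).\,T\to^0T$ if $x$ not free in $T$; $L\vdash\mathrm{app}(V,\mathrm{def}(x{=}W).\,T)\to^0\mathrm{def}(x{=}W).\,\mathrm{app}(V,T)$;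 $L\vdash\mathrm{cast}(U,T)\to^0T$; $L\vdash\star s\to^1\star\,\mathrm{next}(s)$; $K,x{:}W\vdash x\to^1W$; $L\vdash\mathrm{cast}(U,T)\to^1U$; if $K\vdash x\to^nT$, $y\neq x$, $y$ not free in $T$ then $K,y[V]\vdash x\to^nT$; if $L\vdash V_1\to^0V_2$ then $L\vdash\mathrm{app}(V_1,T)\to^0\mathrm{app}(V_2,T)$; if $L\vdash T_1\to^nT_2$ then $L\vdash\mathrm{app}(V,T_1)\to^n\mathrm{app}(V,T_2)$; if $L\vdash V_1\to^0V_2$ then $L\vdash\mathsf Bx[V_1].\,T\to^0\mathsf Bx[V_2].\,T$; if $L,x[V]\vdash T_1\to^nT_2$ then $L\vdash\mathsf Bx[V].\,T_1\to^n\mathsf Bx[V].\,T_2$; if $L\vdash U_1\to^0U_2$ then $L\vdash\mathrm{cast}(U_1,T)\to^0\mathrm{cast}(U_2,T)$; if $L\vdash T_1\to^0T_2$ then $L\vdash\mathrm{cast}(U,T_1)\to^0\mathrm{cast}(U,T_2)$; if $L\vdash U_1\to^1U_2$ and $L\vdash T_1\to^1T_2$ then $L\vdash\mathrm{cast}(U_1,T_1)\to^1\mathrm{cast}(U_2,T_2)$. $L\vdash T_1\to^{*n}T_2$ is the smallest relation with $L\vdash T\to^{*0}T$, containing single steps, and with $L\vdash T_1\to^{*n_1}T$, $L\vdash T\to^{*n_2}T_2$ implying $L\vdash T_1\to^{*n_1+n_2}T_2$. A term $T$ is r-normal in $L$ if every $T'$ with $L\vdash T\to^{*0}T'$ equals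 $T$. Arities are $A,B::=\circ\mid B\Rightarrow A$. Arity assignment $L\vdash T::A$ is the smallest relation closed under: $L\vdash\star s::\circ$; if $K\vdash V::A$ then $K,x[V]\vdash x::A$; if $K\vdash x::A$ and $y\neq x$ then $K,y[V]\vdash x::A$; if $L\vdash W::B$ and $L,x{:}W\vdash T::A$ then $L\vdash\lambda x{:}W.\,T::B\Rightarrow A$; if $L\vdash V::B$ and $L,x{=}V\vdash T::A$ then $L\vdash\mathrm{def}(x{=}V).\,T::A$; if $L\vdash V::B$ and $L\vdash T::B\Rightarrow A$ then $L\vdash\mathrm{app}(V,T)::A$; if $L\vdash U::A$ and $L\vdash T::A$ then $L\vdash\mathrm{cast}(U,T)::A$. *)

theory Defs
  imports Main
begin

(*
  Terms and environments are taken modulo renaming of bound variables and are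
  represented with de Bruijn indices.  "Bind Abst W T" and "Bind Abbr V T" are
  the abstraction (\<lambda>x:W. T) and the local definition (def(x=V). T); in both,
  index 0 of T refers to x, while W resp. V lies outside the scope of x.
  "Bind b V T" is thus the notation Bx[V]. T of the calculus.
*)

datatype bkind = Abst | Abbr

datatype 's trm =
    Sort 's
  | Var nat
  | App "'s trm" "'s trm"  (* App V T applies T to V: the argument comes first *)
  | Bind bkind "'s trm" "'s trm"
  | Cast "'s trm" "'s trm"  (* Cast U T: the expected type U comes first *)

abbreviation Lam :: "'s trm \<Rightarrow> 's trm \<Rightarrow> 's trm" where
  "Lam W T \<equiv> Bind Abst W T"

abbreviation Def :: "'s trm \<Rightarrow> 's trm \<Rightarrow> 's trm" where
  "Def V T \<equiv> Bind Abbr V T"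

(*
  The head of the list is the innermost (rightmost) entry: K,x:W is
  (Abst, W) # K and K,x=V is (Abbr, V) # K.  The entry at position i is bound by
  index i, and its term lives in the environment formed by the entries after it.
  Environments are arbitrary; an index not below the length of the environment
  is a variable that the environment does not bind.
*)
type_synonym 's env = "(bkind \<times> 's trm) list"

(*
  lift k T inserts a fresh variable at index k.  The terms in which x (index 0)
  is not free are exactly those of the form lift 0 T, where T is the same term
  seen outside the scope of x.
*)
primrec lift :: "nat \<Rightarrow> 's trm \<Rightarrow> 's trm" where
  "lift k (Sort s) = Sort s"
| "lift k (Var i) = Var (if i < k then i else Suc i)"
| "lift k (App V T) = App (lift k V) (lift k T)"
| "lift k (Bind b V T) = Bind b (lift k V) (lift (Suc k) T)"
| "lift k (Cast U T) = Cast (lift k U) (lift k T)"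

(* rt_step nxt L n T1 T2 is one step L |- T1 -->^n T2, with nxt the function on sorts. *)
inductive rt_step :: "('s \<Rightarrow> 's) \<Rightarrow> 's env \<Rightarrow> nat \<Rightarrow> 's trm \<Rightarrow> 's trm \<Rightarrow> bool"
  for nxt :: "'s \<Rightarrow> 's" where
  beta: "rt_step nxt L 0 (App V (Lam W T)) (Def (Cast W V) T)"
| delta: "rt_step nxt ((Abbr, V) # K) 0 (Var 0) (lift 0 V)"
| zeta: "rt_step nxt L 0 (Def V (lift 0 T)) T"
| theta: "rt_step nxt L 0 (App V (Def W T)) (Def W (App (lift 0 V) T))"
| eps: "rt_step nxt L 0 (Cast U T) T"
| sort: "rt_step nxt L 1 (Sort s) (Sort (nxt s))"
| decl: "rt_step nxt ((Abst, W) # K) 1 (Var 0) (lift 0 W)"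
| ee: "rt_step nxt L 1 (Cast U T) U"
| drop: "rt_step nxt K n (Var i) T \<Longrightarrow> rt_step nxt ((b, V) # K) n (Var (Suc i)) (lift 0 T)"
| app_left: "rt_step nxt L 0 V1 V2 \<Longrightarrow> rt_step nxt L 0 (App V1 T) (App V2 T)"
| app_right: "rt_step nxt L n T1 T2 \<Longrightarrow> rt_step nxt L n (App V T1) (App V T2)"
| bind_left: "rt_step nxt L 0 V1 V2 \<Longrightarrow> rt_step nxt L 0 (Bind b V1 T) (Bind b V2 T)"
| bind_right: "rt_step nxt ((b, V) # L) n T1 T2 \<Longrightarrow> rt_step nxt L n (Bind b V T1) (Bind b V T2)"
| cast_left: "rt_step nxt L 0 U1 U2 \<Longrightarrow> rt_step nxt L 0 (Cast U1 T) (Cast U2 T)"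
| cast_right: "rt_step nxt L 0 T1 T2 \<Longrightarrow> rt_step nxt L 0 (Cast U T1) (Cast U T2)"
| cast_both: "\<lbrakk>rt_step nxt L 1 U1 U2; rt_step nxt L 1 T1 T2\<rbrakk>
    \<Longrightarrow> rt_step nxt L 1 (Cast U1 T1) (Cast U2 T2)"

inductive rt_steps :: "('s \<Rightarrow> 's) \<Rightarrow> 's env \<Rightarrow> nat \<Rightarrow> 's trm \<Rightarrow> 's trm \<Rightarrow> bool"
  for nxt :: "'s \<Rightarrow> 's" where
  refl: "rt_steps nxt L 0 T T"
| step: "rt_step nxt L n T1 T2 \<Longrightarrow> rt_steps nxt L n T1 T2"
| trans: "\<lbrakk>rt_steps nxt L n1 T1 T; rt_steps nxt L n2 T T2\<rbrakk> \<Longrightarrow> rt_steps nxt L (n1 + n2) T1 T2"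

definition r_normal :: "('s \<Rightarrow> 's) \<Rightarrow> 's env \<Rightarrow> 's trm \<Rightarrow> bool" where
  "r_normal nxt L T \<longleftrightarrow> (\<forall>T'. rt_steps nxt L 0 T T' \<longrightarrow> T' = T)"

datatype arity = Base | Arrow arity arity  (* Arrow B A is B \<Rightarrow> A *)

inductive has_arity :: "'s env \<Rightarrow> 's trm \<Rightarrow> arity \<Rightarrow> bool" where
  sort: "has_arity L (Sort s) Base"
| head: "has_arity K V A \<Longrightarrow> has_arity ((b, V) # K) (Var 0) A"
| drop: "has_arity K (Var i) A \<Longrightarrow> has_arity ((b, V) # K) (Var (Suc i)) A"
| lam: "\<lbrakk>has_arity L W B; has_arity ((Abst, W) # L) T A\<rbrakk> \<Longrightarrow> has_arity L (Lam W T) (Arrow B A)"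
| "def": "\<lbrakk>has_arity L V B; has_arity ((Abbr, V) # L) T A\<rbrakk> \<Longrightarrow> has_arity L (Def V T) A"
| app: "\<lbrakk>has_arity L V B; has_arity L T (Arrow B A)\<rbrakk> \<Longrightarrow> has_arity L (App V T) A"
| cast: "\<lbrakk>has_arity L U A; has_arity L T A\<rbrakk> \<Longrightarrow> has_arity L (Cast U T) A"

end

theory Submission
  imports Defs
begin

text \<open>
  Weak normalization is proved by hereditary substitution.  In a redex
  \<open>app(V, \<lambda>x:W. T)\<close> with \<open>V\<close> and \<open>T\<close> r-normal, unfolding \<open>x\<close> in \<open>T\<close> creates
  a new redex only where the head of an application unfolds to an abstraction; the
  argument arity there is a proper part of the arity of \<open>V\<close>, so an induction on that arity
  terminates.  Since neither r-steps nor t-steps change the arity, and an r-normal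
  term with an arity always admits a t-step, normalizing and making a t-step
  alternately \<open>n\<close> times yields the result.
\<close>

subsection \<open>Arity inference\<close>

text \<open>The context is a function on indices, so that lifting a term becomes a reindexing. It
  records arities only, because a variable inherits the arity of its entry whether that is a
  declaration or a definition.\<close>

fun infer :: "(nat \<Rightarrow> arity option) \<Rightarrow> 's trm \<Rightarrow> arity option" where
  "infer \<Gamma> (Sort s) = Some Base"
| "infer \<Gamma> (Var i) = \<Gamma> i"
| "infer \<Gamma> (App V T) =
    (case infer \<Gamma> T of
       Some (Arrow B A) \<Rightarrow> if infer \<Gamma> V = Some B then Some A else None
     | _ \<Rightarrow> None)"
| "infer \<Gamma> (Bind b V T) =
    (case infer \<Gamma> V of
       Some B \<Rightarrow> map_option (if b = Abst then Arrow B else id) (infer (case_nat (Some B) \<Gamma>) T)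
     | None \<Rightarrow> None)"
| "infer \<Gamma> (Cast U T) = (if infer \<Gamma> U = infer \<Gamma> T then infer \<Gamma> T else None)"

lemma infer_App_iff:
  "infer \<Gamma> (App V T) = Some A \<longleftrightarrow> (\<exists>B. infer \<Gamma> V = Some B \<and> infer \<Gamma> T = Some (Arrow B A))"
  by (auto split: option.splits arity.splits)

lemma infer_Lam_iff:
  "infer \<Gamma> (Lam W T) = Some A \<longleftrightarrow>
    (\<exists>B C. infer \<Gamma> W = Some B \<and> infer (case_nat (Some B) \<Gamma>) T = Some C \<and> A = Arrow B C)"
  by (auto split: option.splits)

lemma infer_Def_iff:
  "infer \<Gamma> (Def V T) = Some A \<longleftrightarrow>
    (\<exists>B. infer \<Gamma> V = Some B \<and> infer (case_nat (Some B) \<Gamma>) T = Some A)"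
  by (auto split: option.splits)

lemma infer_Cast_iff:
  "infer \<Gamma> (Cast U T) = Some A \<longleftrightarrow> infer \<Gamma> U = Some A \<and> infer \<Gamma> T = Some A"
  by auto

declare infer.simps(3-5) [simp del]
lemmas infer_iffs = infer_App_iff infer_Lam_iff infer_Def_iff infer_Cast_iff

lemma case_nat_skip:
  "(\<lambda>i. case_nat a f (if i < Suc k then i else Suc i)) =
    case_nat a (\<lambda>i. f (if i < k then i else Suc i))"
  by (auto simp: fun_eq_iff split: nat.split)

lemma infer_lift:
  "infer \<Gamma> (lift k T) = infer (\<lambda>i. \<Gamma> (if i < k then i else Suc i)) T"
proof (induction T arbitrary: k \<Gamma>)
  case (Bind b V T)
  show ?case
    by (simp add: Bind infer.simps(4) case_nat_skip split: option.split)
qed (simp_all add: infer.simps split: option.split arity.split)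

lemma infer_lift_0 [simp]: "infer (case_nat a \<Gamma>) (lift 0 T) = infer \<Gamma> T"
  by (simp add: infer_lift)

primrec var_arity :: "'s env \<Rightarrow> nat \<Rightarrow> arity option" where
  "var_arity [] = (\<lambda>i. None)"
| "var_arity (e # K) = case_nat (infer (var_arity K) (snd e)) (var_arity K)"

lemma has_arity_imp_infer: "has_arity L T A \<Longrightarrow> infer (var_arity L) T = Some A"
  by (induction rule: has_arity.induct) (auto simp: infer_iffs)

subsection \<open>Normal forms\<close>

primrec abbrs :: "'s env \<Rightarrow> nat \<Rightarrow> bool" where
  "abbrs [] = (\<lambda>i. False)"
| "abbrs (e # K) = case_nat (fst e = Abbr) (abbrs K)"

text \<open>Both binders count, since an application of either one is a redex, by
  \<open>beta\<close> or by \<open>theta\<close>.\<close>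

primrec is_Bind :: "'s trm \<Rightarrow> bool" where
  "is_Bind (Sort s) = False"
| "is_Bind (Var i) = False"
| "is_Bind (App V T) = False"
| "is_Bind (Bind b V T) = True"
| "is_Bind (Cast U T) = False"

text \<open>
  Neither a definition nor a cast is normal: in the body of a definition that is
  itself normal the defined variable has been unfolded, so \<open>zeta\<close> applies.
\<close>

primrec nf :: "(nat \<Rightarrow> bool) \<Rightarrow> 's trm \<Rightarrow> bool" where
  "nf \<delta> (Sort s) = True"
| "nf \<delta> (Var i) = (\<not> \<delta> i)"
| "nf \<delta> (App V T) = (nf \<delta> V \<and> nf \<delta> T \<and> \<not> is_Bind T)"
| "nf \<delta> (Bind b V T) = (b = Abst \<and> nf \<delta> V \<and> nf (case_nat False \<delta>) T)"
| "nf \<delta> (Cast U T) = False"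

lemma is_Bind_lift [simp]: "is_Bind (lift k T) = is_Bind T"
  by (cases T) auto

lemma nf_lift: "nf \<delta> (lift k T) = nf (\<lambda>i. \<delta> (if i < k then i else Suc i)) T"
  by (induction T arbitrary: k \<delta>) (simp_all add: case_nat_skip)

lemma nf_lift_0 [simp]: "nf (case_nat a \<delta>) (lift 0 T) = nf \<delta> T"
  by (simp add: nf_lift)

text \<open>A normal term contains no variable marked as defined, so \<open>k\<close> is not free in
  it. This is what makes \<open>zeta\<close> applicable.\<close>

lemma nf_imp_lift:
  assumes "nf \<delta> T" and "\<delta> k"
  shows "\<exists>T'. T = lift k T'"
  using assms
proof (induction T arbitrary: k \<delta>)
  case (Sort s)
  show ?case by (rule exI [of _ "Sort s"]) simp
next
  case (Var i)
  then have "i \<noteq> k" by auto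
  then have "Var i = lift k (Var (if i < k then i else i - 1) :: 's trm)" by auto
  then show ?case by blast
next
  case (App V T)
  then obtain V' T' where "V = lift k V'" "T = lift k T'" by fastforce
  then show ?case by (metis lift.simps(3))
next
  case (Bind b V T)
  have "nf \<delta> V" "nf (case_nat False \<delta>) T" "case_nat False \<delta> (Suc k)"
    using Bind.prems by auto
  then obtain V' T' where "V = lift k V'" "T = lift (Suc k) T'"
    using Bind by meson
  then show ?case by (metis lift.simps(4))
qed simp

lemma nf_no_r_step: "rt_step nxt L n T T' \<Longrightarrow> n = 0 \<Longrightarrow> \<not> nf (abbrs L) T"
proof (induction rule: rt_step.induct)
  case (bind_right b V L n T1 T2)
  then show ?case by (cases b) auto
qed auto

lemma nf_imp_r_normal:
  assumes "nf (abbrs L) T"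
  shows "r_normal nxt L T"
proof -
  have "T' = T" if "rt_steps nxt L n T T'" "n = 0" "nf (abbrs L) T" for n T T'
    using that by (induction rule: rt_steps.induct) (auto dest: nf_no_r_step)
  with assms show ?thesis unfolding r_normal_def by blast
qed

subsection \<open>Weakening and congruence of r-steps\<close>

text \<open>The term of the head entry lives in the tail, where the fresh entry sits at position
  \<open>k\<close>; hence it is lifted at \<open>k\<close> and not at \<open>Suc k\<close>.\<close>

inductive inserted :: "nat \<Rightarrow> 's env \<Rightarrow> 's env \<Rightarrow> bool" where
  inserted_0: "inserted 0 K ((b, V) # K)"
| inserted_Suc: "inserted k K L \<Longrightarrow> inserted (Suc k) ((b, V) # K) ((b, lift k V) # L)"

lemma lift_lift: "j \<le> k \<Longrightarrow> lift (Suc k) (lift j T) = lift j (lift k T)"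
  by (induction T arbitrary: j k) auto

text \<open>The position is arbitrary because going under a binder moves the fresh entry one place
  outwards. For variables, a fresh entry at the front is passed by \<open>drop\<close>; otherwise
  \<open>lift_lift\<close> commutes the two lifts.\<close>

lemma rt_step_lift:
  "rt_step nxt K n T T' \<Longrightarrow> inserted k K L \<Longrightarrow> rt_step nxt L n (lift k T) (lift k T')"
proof (induction arbitrary: k L rule: rt_step.induct)
  case (delta V K)
  from delta show ?case
    by cases (auto simp: lift_lift intro: rt_step.delta rt_step.drop)
next
  case (decl W K)
  from decl show ?case
    by cases (auto simp: lift_lift intro: rt_step.decl[simplified] rt_step.drop)
next
  case (drop K n i T b V)
  from drop.prems show ?case
  proof cases
    case (inserted_0 c U)
    then show ?thesis using drop.hyps by (simp add: rt_step.drop)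
  next
    case (inserted_Suc j L')
    with drop.IH have "rt_step nxt L' n (lift j (Var i)) (lift j T)" by blast
    then have "rt_step nxt ((b, lift j V) # L') n
        (Var (Suc (if i < j then i else Suc i))) (lift 0 (lift j T))"
      by (auto intro: rt_step.drop)
    moreover have "lift k (Var (Suc i)) = (Var (Suc (if i < j then i else Suc i)) :: 's trm)"
      using inserted_Suc by auto
    ultimately show ?thesis using inserted_Suc by (simp add: lift_lift)
  qed
next
  case (zeta L V T)
  then show ?case by (simp add: lift_lift rt_step.zeta)
next
  case (theta L V W T)
  then show ?case by (simp add: lift_lift rt_step.theta)
qed (auto intro: rt_step.intros rt_step.sort[simplified] rt_step.ee[simplified]
  rt_step.cast_both[simplified] inserted.intros)

abbreviation r_steps :: "('s \<Rightarrow> 's) \<Rightarrow> 's env \<Rightarrow> 's trm \<Rightarrow> 's trm \<Rightarrow> bool" where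
  "r_steps nxt L \<equiv> (rt_step nxt L 0)\<^sup>*\<^sup>*"

lemma rtranclp_image:
  "r\<^sup>*\<^sup>* x y \<Longrightarrow> (\<And>x y. r x y \<Longrightarrow> s (f x) (f y)) \<Longrightarrow> s\<^sup>*\<^sup>* (f x) (f y)"
  by (induction rule: rtranclp_induct) (auto intro: rtranclp.rtrancl_into_rtrancl)

lemma r_steps_lift: "r_steps nxt K T T' \<Longrightarrow> r_steps nxt ((b, V) # K) (lift 0 T) (lift 0 T')"
  by (erule rtranclp_image) (auto intro: rt_step_lift inserted_0)

lemma r_steps_App:
  assumes "r_steps nxt L V V'" and "r_steps nxt L T T'"
  shows "r_steps nxt L (App V T) (App V' T')"
proof -
  have "r_steps nxt L (App V T) (App V' T)"
    using assms(1) by (rule rtranclp_image) (rule rt_step.app_left)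
  also have "r_steps nxt L (App V' T) (App V' T')"
    using assms(2) by (rule rtranclp_image) (rule rt_step.app_right)
  finally show ?thesis .
qed

lemma r_steps_Bind:
  assumes "r_steps nxt L V V'" and "r_steps nxt ((b, V) # L) T T'"
  shows "r_steps nxt L (Bind b V T) (Bind b V' T')"
proof -
  \<comment> \<open>The body goes first: its steps are given under the original entry
    \<open>V\<close>.\<close>
  have "r_steps nxt L (Bind b V T) (Bind b V T')"
    using assms(2) by (rule rtranclp_image) (rule rt_step.bind_right)
  also have "r_steps nxt L (Bind b V T') (Bind b V' T')"
    using assms(1) by (rule rtranclp_image) (rule rt_step.bind_left)
  finally show ?thesis .
qed

lemma r_steps_imp_rt_steps: "r_steps nxt L T T' \<Longrightarrow> rt_steps nxt L 0 T T'"
proof (induction rule: rtranclp_induct)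
  case (step T T')
  then show ?case using rt_steps.trans [of nxt L 0 _ T 0 T'] rt_steps.step by fastforce
qed (rule rt_steps.refl)

subsection \<open>Weak normalization\<close>

text \<open>Carrying the arity of \<open>N\<close> along establishes preservation of arity just for
  the reductions that are constructed.\<close>

definition normalizes :: "('s \<Rightarrow> 's) \<Rightarrow> 's env \<Rightarrow> 's trm \<Rightarrow> 's trm \<Rightarrow> arity \<Rightarrow> bool" where
  "normalizes nxt L T N A \<longleftrightarrow>
    r_steps nxt L T N \<and> nf (abbrs L) N \<and> infer (var_arity L) N = Some A"

lemma normalizes_lift:
  "normalizes nxt L T N A \<Longrightarrow> normalizes nxt ((b, V) # L) (lift 0 T) (lift 0 N) A"
  unfolding normalizes_def by (auto intro: r_steps_lift)

lemma normalizes_Lam: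
  assumes "normalizes nxt L W W' B" and "normalizes nxt ((Abst, W) # L) T T' A"
    and "infer (var_arity L) W = Some B"
  shows "normalizes nxt L (Lam W T) (Lam W' T') (Arrow B A)"
  using assms unfolding normalizes_def by (auto simp: infer_iffs intro: r_steps_Bind)

text \<open>The defined variable has been unfolded in the normal body, so \<open>nf_imp_lift\<close>
  allows \<open>zeta\<close> to remove the definition.\<close>

lemma normalizes_Def:
  assumes "normalizes nxt ((Abbr, V) # L) T N A"
  obtains N' where "normalizes nxt L (Def V T) N' A"
proof -
  from assms have "nf (abbrs ((Abbr, V) # L)) N"
    unfolding normalizes_def by blast
  then obtain N' where N: "N = lift 0 N'"
    using nf_imp_lift [of _ N 0] by fastforce
  from assms have "r_steps nxt L (Def V T) (Def V (lift 0 N'))"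
    unfolding normalizes_def N by (intro r_steps_Bind) auto
  then have "r_steps nxt L (Def V T) N'"
    by (rule rtranclp.rtrancl_into_rtrancl) (rule rt_step.zeta)
  with assms that [of N'] show thesis unfolding normalizes_def N by simp
qed

text \<open>Normalization after unfolding a variable of arity \<open>B\<close> is a hypothesis, so
  that it can be supplied by an induction hypothesis inside \<open>hereditary_substitution\<close>
  and by that lemma itself afterwards.\<close>

lemma normalizes_App:
  assumes V: "normalizes nxt L V N1 B" and T: "normalizes nxt L T N2 (Arrow B A)"
    and unfold: "\<And>L k M T A. \<lbrakk>normalizes nxt L (Var k) M B; var_arity L k = Some B;
      nf ((abbrs L)(k := False)) T; infer (var_arity L) T = Some A\<rbrakk> \<Longrightarrow> \<exists>N. normalizes nxt L T N A"
  shows "\<exists>N. normalizes nxt L (App V T) N A"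
proof (cases "is_Bind N2")
  case False
  with V T have "normalizes nxt L (App V T) (App N1 N2) A"
    by (auto simp: normalizes_def infer_iffs intro: r_steps_App)
  then show ?thesis by blast
next
  case True
  then obtain W T' where N2: "N2 = Lam W T'"
    using T by (cases N2) (auto simp: normalizes_def)
  have W: "infer (var_arity L) W = Some B"
    and T': "infer (case_nat (Some B) (var_arity L)) T' = Some A"
      "nf (case_nat False (abbrs L)) T'"
    using T by (auto simp: normalizes_def N2 infer_iffs)
  let ?D = "Cast W N1"
  let ?L = "(Abbr, ?D) # L"
  have D: "infer (var_arity L) ?D = Some B"
    using W V by (simp add: infer_iffs normalizes_def)
  \<comment> \<open>The definition created by \<open>beta\<close> carries a cast:
    \<open>delta\<close> unfolds it and \<open>eps\<close> strips it, which leaves the normal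
    argument.\<close>
  have "r_steps nxt ?L (Var 0) (lift 0 N1)"
    using rt_step.delta [of nxt ?D L] rt_step.eps [of nxt ?L "lift 0 W" "lift 0 N1"]
    by (auto intro: rtranclp.rtrancl_into_rtrancl)
  then have "normalizes nxt ?L (Var 0) (lift 0 N1) B"
    using V by (simp add: normalizes_def)
  moreover have "var_arity ?L 0 = Some B" "infer (var_arity ?L) T' = Some A"
    using D T' by simp_all
  \<comment> \<open>\<open>T'\<close> was normal with index 0 declared, and turning the declaration
    into a definition affects index 0 only.\<close>
  moreover have "(abbrs ?L)(0 := False) = case_nat False (abbrs L)"
    by (auto simp: fun_eq_iff split: nat.split)
  then have "nf ((abbrs ?L)(0 := False)) T'"
    using T' by simp
  ultimately obtain N3 where "normalizes nxt ?L T' N3 A"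
    using unfold by blast
  then obtain N where N: "normalizes nxt L (Def ?D T') N A"
    by (rule normalizes_Def)
  have "r_steps nxt L (App V T) (App N1 (Lam W T'))"
    using V T unfolding normalizes_def N2 by (blast intro: r_steps_App)
  then have "r_steps nxt L (App V T) (Def ?D T')"
    by (rule rtranclp.rtrancl_into_rtrancl) (rule rt_step.beta)
  with N have "normalizes nxt L (App V T) N A"
    unfolding normalizes_def by (auto intro: rtranclp_trans)
  then show ?thesis by blast
qed

text \<open>
  The index \<open>k\<close> is the variable being unfolded, and \<open>M\<close> the normal form of its
  definition.  The last conjunct says that \<open>T\<close> turns into an abstraction only when its
  head is \<open>k\<close>, in which case its arity is a part of the arity of \<open>k\<close>.
\<close>

lemma hereditary_substitution:
  assumes "normalizes nxt L (Var k) M B" and "var_arity L k = Some B"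
    and "nf ((abbrs L)(k := False)) T" and "infer (var_arity L) T = Some A"
  shows "\<exists>N. normalizes nxt L T N A \<and> (is_Bind N \<longrightarrow> is_Bind T \<or> size A \<le> size B)"
  using assms
proof (induction "size B" arbitrary: B L k M T A rule: less_induct)
  case outer: less
  from outer.prems show ?case
  proof (induction T arbitrary: L k M A)
    case (Sort s)
    then show ?case by (intro exI [of _ "Sort s"]) (simp add: normalizes_def)
  next
    case (Var i)
    show ?case
    proof (cases "i = k")
      case True
      with Var show ?thesis by (intro exI [of _ M]) simp
    next
      case False
      with Var show ?thesis by (intro exI [of _ "Var i"]) (simp add: normalizes_def)
    qed
  next
    case (App V T)
    obtain C where C: "infer (var_arity L) V = Some C" "infer (var_arity L) T = Some (Arrow C A)"
      using App.prems(4) by (auto simp: infer_iffs)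
    obtain N1 where N1: "normalizes nxt L V N1 C"
      using App.IH(1) [OF App.prems(1,2) _ C(1)] App.prems(3) by auto
    \<comment> \<open>Normality of \<open>App V T\<close> up to \<open>k\<close> excludes a binder
      \<open>T\<close>, so only the size alternative of the induction hypothesis remains.\<close>
    obtain N2 where N2: "normalizes nxt L T N2 (Arrow C A)"
      and size: "is_Bind N2 \<Longrightarrow> size (Arrow C A) \<le> size B"
      using App.IH(2) [OF App.prems(1,2) _ C(2)] App.prems(3) by auto
    show ?case
    proof (cases "is_Bind N2")
      case True
      \<comment> \<open>\<open>C\<close> is a proper part of \<open>Arrow C A\<close>, so the outer
        induction covers the new redex. The bound on \<open>A\<close> follows likewise.\<close>
      with size have "size C < size B" by fastforce
      then obtain N where "normalizes nxt L (App V T) N A"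
        using normalizes_App [OF N1 N2] outer.hyps by blast
      with size [OF True] show ?thesis by auto
    next
      case False
      have "normalizes nxt L (App V T) (App N1 N2) A"
        using N1 N2 False by (auto simp: normalizes_def infer_iffs intro: r_steps_App)
      then show ?thesis by auto
    qed
  next
    case (Bind b W T)
    have b: "b = Abst" using Bind.prems(3) by simp
    obtain C D where CD: "infer (var_arity L) W = Some C"
      "infer (case_nat (Some C) (var_arity L)) T = Some D" "A = Arrow C D"
      using Bind.prems(4) by (auto simp: infer_iffs b)
    let ?L = "(Abst, W) # L"
    obtain N1 where N1: "normalizes nxt L W N1 C"
      using Bind.IH(1) [OF Bind.prems(1,2) _ CD(1)] Bind.prems(3) by auto
    have "normalizes nxt ?L (Var (Suc k)) (lift 0 M) B"
      using normalizes_lift [OF Bind.prems(1), of Abst W] by simp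
    moreover have "var_arity ?L (Suc k) = Some B" "infer (var_arity ?L) T = Some D"
      using Bind.prems(2) CD by simp_all
    moreover have "(abbrs ?L)(Suc k := False) = case_nat False ((abbrs L)(k := False))"
      by (auto simp: fun_eq_iff split: nat.split)
    then have "nf ((abbrs ?L)(Suc k := False)) T"
      using Bind.prems(3) by (simp del: fun_upd_apply)
    ultimately obtain N2 where N2: "normalizes nxt ?L T N2 D"
      using Bind.IH(2) by blast
    show ?case
      using normalizes_Lam [OF N1 N2 CD(1)] by (auto simp: b CD(3))
  qed simp
qed

text \<open>A declared variable is already normal, and a defined one reduces by \<open>delta\<close>
  to its lifted definition. Variables further out are handled by weakening.\<close>

lemma normalizes_Var_Cons:
  assumes "var_arity ((b, V) # K) i = Some A"
    and "\<And>i A. var_arity K i = Some A \<Longrightarrow> \<exists>N. normalizes nxt K (Var i) N A"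
    and "\<And>B. infer (var_arity K) V = Some B \<Longrightarrow> \<exists>N. normalizes nxt K V N B"
  shows "\<exists>N. normalizes nxt ((b, V) # K) (Var i) N A"
proof (cases i)
  case 0
  with assms(1,3) obtain N where "normalizes nxt K V N A" by auto
  then have N: "normalizes nxt ((b, V) # K) (lift 0 V) (lift 0 N) A"
    by (rule normalizes_lift)
  show ?thesis
  proof (cases b)
    case Abst
    with 0 assms(1) show ?thesis
      by (intro exI [of _ "Var 0"]) (simp add: normalizes_def)
  next
    case Abbr
    then have "rt_step nxt ((b, V) # K) 0 (Var 0) (lift 0 V)"
      by (simp add: rt_step.delta)
    with N 0 show ?thesis
      unfolding normalizes_def by (meson converse_rtranclp_into_rtranclp)
  qed
next
  case (Suc j)
  with assms(1,2) obtain N where "normalizes nxt K (Var j) N A" by auto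
  from normalizes_lift [OF this, of b V] Suc show ?thesis by auto
qed

text \<open>A definition stored in \<open>L\<close> is not a subterm of \<open>T\<close>, so
  structural induction cannot reach it. Normalization of variables is therefore assumed here,
  extended at each binder, and discharged by induction on the environment in
  \<open>var_arity_imp_normalizes\<close>.\<close>

lemma infer_imp_normalizes:
  assumes "\<And>i A. var_arity L i = Some A \<Longrightarrow> \<exists>N. normalizes nxt L (Var i) N A"
    and "infer (var_arity L) T = Some A"
  shows "\<exists>N. normalizes nxt L T N A"
  using assms
proof (induction T arbitrary: L A)
  case (Sort s)
  then show ?case by (intro exI [of _ "Sort s"]) (simp add: normalizes_def)
next
  case (App V T)
  from App.prems(2) obtain B where B: "infer (var_arity L) V = Some B"
    "infer (var_arity L) T = Some (Arrow B A)"
    by (auto simp: infer_iffs)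
  obtain N1 N2 where "normalizes nxt L V N1 B" "normalizes nxt L T N2 (Arrow B A)"
    using App.IH(1) [OF App.prems(1) B(1)] App.IH(2) [OF App.prems(1) B(2)] by blast
  then show ?case
    by (rule normalizes_App) (use hereditary_substitution in blast)
next
  case (Bind b V T)
  from Bind.prems(2) obtain B C where BC: "infer (var_arity L) V = Some B"
    "infer (var_arity ((b, V) # L)) T = Some C" "A = (if b = Abst then Arrow B C else C)"
    by (cases b) (auto simp: infer_iffs)
  obtain N1 where N1: "normalizes nxt L V N1 B"
    using Bind.IH(1) [OF Bind.prems(1) BC(1)] by blast
  have "\<exists>N. normalizes nxt ((b, V) # L) (Var i) N D"
    if "var_arity ((b, V) # L) i = Some D" for i D
    using that Bind.prems(1)
    by (rule normalizes_Var_Cons) (use N1 BC(1) in auto)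
  then obtain N2 where N2: "normalizes nxt ((b, V) # L) T N2 C"
    using Bind.IH(2) [OF _ BC(2)] by blast
  show ?case
  proof (cases b)
    case Abst
    with N1 N2 BC show ?thesis by (auto intro: normalizes_Lam)
  next
    case Abbr
    with N2 BC show ?thesis by (auto elim: normalizes_Def)
  qed
next
  case (Cast U T)
  from Cast.prems(2) have "infer (var_arity L) T = Some A"
    by (simp add: infer_iffs)
  with Cast.IH(2) [OF Cast.prems(1)] obtain N where "normalizes nxt L T N A"
    by blast
  moreover have "rt_step nxt L 0 (Cast U T) T" by (rule rt_step.eps)
  ultimately show ?case
    unfolding normalizes_def by (meson converse_rtranclp_into_rtranclp)
qed simp

lemma var_arity_imp_normalizes:
  "var_arity L i = Some A \<Longrightarrow> \<exists>N. normalizes nxt L (Var i) N A"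
proof (induction L arbitrary: i A)
  case (Cons e K)
  obtain b V where e: "e = (b, V)" by (cases e)
  have "\<exists>N. normalizes nxt K V N B" if "infer (var_arity K) V = Some B" for B
    using infer_imp_normalizes Cons.IH that by blast
  with Cons show ?case unfolding e by (blast intro: normalizes_Var_Cons)
qed simp

subsection \<open>t-steps\<close>

text \<open>\<open>decl\<close> replaces a declared variable by its type, whose arity is by
  construction that of the variable.\<close>

lemma var_arity_imp_t_step:
  assumes "var_arity L i = Some A" and "\<not> abbrs L i"
  shows "\<exists>T. rt_step nxt L 1 (Var i) T \<and> infer (var_arity L) T = Some A"
  using assms
proof (induction L arbitrary: i)
  case (Cons e K)
  obtain b V where e: "e = (b, V)" by (cases e)
  show ?case
  proof (cases i)
    case 0
    with Cons.prems have "b = Abst" by (cases b) (auto simp: e)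
    with 0 Cons.prems show ?thesis
      by (intro exI [of _ "lift 0 V"]) (auto simp: e intro: rt_step.decl [simplified])
  next
    case (Suc j)
    with Cons obtain T where "rt_step nxt K 1 (Var j) T" "infer (var_arity K) T = Some A"
      by auto
    with Suc show ?thesis
      by (intro exI [of _ "lift 0 T"]) (auto simp: e intro: rt_step.drop)
  qed
qed simp

text \<open>Descending through functions of applications and bodies of abstractions ends at a sort
  or a variable. Normality excludes casts and defined variables, and the arity excludes unbound
  variables, which have no step.\<close>

lemma nf_imp_t_step:
  assumes "nf (abbrs L) T" and "infer (var_arity L) T = Some A"
  shows "\<exists>T'. rt_step nxt L 1 T T' \<and> infer (var_arity L) T' = Some A"
  using assms
proof (induction T arbitrary: L A)
  case (Sort s)
  then show ?case
    using rt_step.sort [of nxt L s] by (intro exI [of _ "Sort (nxt s)"]) simp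
next
  case (Var i)
  then show ?case by (simp add: var_arity_imp_t_step [simplified])
next
  case (App V T)
  from App.prems obtain B where B: "infer (var_arity L) V = Some B"
    "infer (var_arity L) T = Some (Arrow B A)" by (auto simp: infer_iffs)
  with App obtain T' where "rt_step nxt L 1 T T'" "infer (var_arity L) T' = Some (Arrow B A)"
    by force
  with B show ?case
    by (intro exI [of _ "App V T'"]) (auto simp: infer_iffs intro: rt_step.app_right)
next
  case (Bind b W T)
  then have b: "b = Abst" by simp
  from Bind.prems obtain B C where BC: "infer (var_arity L) W = Some B"
    "infer (var_arity ((b, W) # L)) T = Some C" "A = Arrow B C"
    by (auto simp: infer_iffs b)
  have "nf (abbrs ((b, W) # L)) T" using Bind.prems by simp
  then obtain T' where "rt_step nxt ((b, W) # L) 1 T T'"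
    "infer (var_arity ((b, W) # L)) T' = Some C"
    using Bind.IH(2) BC by blast
  with BC show ?case
    by (intro exI [of _ "Lam W T'"]) (auto simp: infer_iffs b intro: rt_step.bind_right)
qed simp

text \<open>Normality and arity of \<open>N\<close> belong to the induction claim because the next
  t-step depends on both.\<close>

lemma infer_imp_rt_steps:
  assumes "infer (var_arity L) T = Some A"
  shows "\<exists>N. rt_steps nxt L n T N \<and> nf (abbrs L) N \<and> infer (var_arity L) N = Some A"
proof (induction n)
  case 0
  have "\<exists>N. normalizes nxt L T N A"
    using infer_imp_normalizes var_arity_imp_normalizes assms by blast
  then show ?case unfolding normalizes_def by (blast intro: r_steps_imp_rt_steps)
next
  case (Suc n)
  then obtain N where N: "rt_steps nxt L n T N" "nf (abbrs L) N" "infer (var_arity L) N = Some A"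
    by blast
  from nf_imp_t_step [OF N(2,3)] obtain T'
    where T': "rt_step nxt L 1 N T'" "infer (var_arity L) T' = Some A" by blast
  obtain N' where N': "normalizes nxt L T' N' A"
    using infer_imp_normalizes var_arity_imp_normalizes T'(2) by blast
  then have "rt_steps nxt L 0 T' N'"
    unfolding normalizes_def by (blast intro: r_steps_imp_rt_steps)
  \<comment> \<open>The sum mirrors two uses of \<open>trans\<close>: the previous path, one t-step,
    then renormalization at cost 0.\<close>
  then have "rt_steps nxt L (n + (1 + 0)) T N'"
    using N(1) T'(1) by (blast intro: rt_steps.intros)
  with N' show ?case unfolding normalizes_def by auto
qed

theorem theorem5p2:
  fixes nxt :: "'s \<Rightarrow> 's" and L :: "'s env" and T1 :: "'s trm" and A :: arity
  assumes "has_arity L T1 A"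
  shows "\<forall>n::nat. \<exists>T2. rt_steps nxt L n T1 T2 \<and> r_normal nxt L T2"
  using infer_imp_rt_steps [OF has_arity_imp_infer [OF assms]] nf_imp_r_normal by blast

end
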